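(* Let $d_n=4^{-n}\binom{2n+1}{n}$ for $n\in\mathbb N$. (1) Let $(A_n)_{n\in\mathbb N}$ be a realization of model $A$ with $A_0\sim\mu$. If $\mu$ is the uniform distribution on $\{0,1\}^{\mathbb Z}$ (i.e. the $A_{i,0}$ are i.i.d. with $\mathbb P(A_{0,0}=0)=\mathbb P(A_{0,0}=1)=1/2$), then for all $n\ge0$, $\mathbb P(A_{0,n}A_{1,n}\in\{00,11\})=d_n/2$. If $\mu=\delta_{1^{\mathbb Z}}$, then for all $n\ge1$, $\mathbb P(A_{0,n}A_{1,n}\in\{00,11\})=d_{n-1}/2$. (2) Let $(B_n)_{n\in\mathbb N}$ be a realization of model $B$. If the $B_{i,0}$, $i\in\mathbb Z$, are i.i.d. with $\mathbb P(B_{0,0}=\circ)=\mathbb P(B_{0,0}=\bullet)=1/2$, then for all $n\ge0$, $\mathbb P(B_{0,n}=\bullet)=d_n/2$. If $B_0=\bullet^{\mathbb Z}$, then for all $n\ge1$, $\mathbb P(B_{0,n}=\bullet)=d_{n-1}/2$.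
   Context: $\mathbb N=\{0,1,2,\dots\}$ and $\mathcal U=\{\uparrow,\rightarrow\}$. An update process is a family $U=(U_{i,n})_{(i,n)\in\mathbb Z\times\mathbb N}$ of i.i.d. random variables with $\mathbb P(U_{i,n}=\uparrow)=\mathbb P(U_{i,n}=\rightarrow)=1/2$; write $U_n=(U_{i,n})_{i\in\mathbb Z}$. Model $A$: define $\mathcal A:\{0,1\}^{\mathbb Z}\times\mathcal U^{\mathbb Z}\to\{0,1\}^{\mathbb Z}$ by $\mathcal A(x,u)=\tilde x$ with $\tilde x_i=0$ if $x_{i-1}x_i=01$ or $(x_{i-1}x_i,u_i)\in\{(00,\rightarrow),(11,\uparrow)\}$, and $\tilde x_i=1$ if $x_{i-1}x_i=10$ or $(x_{i-1}x_i,u_i)\in\{(00,\uparrow),(11,\rightarrow)\}$. A realization of model $A$ is a process $(A_n)_{n\in\mathbb N}$, $A_n=(A_{i,n})_{i\in\mathbb Z}$, with $A_{n+1}=\mathcal A(A_n,U_n)$ for all $n$, where $U$ is an update process independent of $A_0$. Model $B$ (annihilating particles): define $\mathcal B:\{\circ,\bullet\}^{\mathbb Z}\times\mathcal U^{\mathbb Z}\to\{\circ,\bullet\}^{\mathbb Z}$ by $\mathcal B(y,u)=\tilde y$, where $\tilde y_i=\bullet$ if one of the following holds: $y_{i-1}y_i=\bullet\circ$ and $u_{i-1}=\rightarrow$; $y_{i-1}y_i=\circ\bullet$ and $u_i=\uparrow$; $y_{i-1}y_i=\bullet\bullet$ and $u_{i-1}u_i\in\{\uparrow\uparrow,\rightarrow\rightarrow\}$;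 and $\tilde y_i=\circ$ otherwise. A realization of model $B$ is a process $(B_n)_{n\in\mathbb N}$, $B_n=(B_{i,n})_{i\in\mathbb Z}$, with $B_{n+1}=\mathcal B(B_n,U_n)$ for all $n$, where $U$ is an update process independent of $B_0$. *)

theory Defs
  imports "HOL-Probability.Probability" "HOL-Library.Z2"
begin

datatype update = Upward | Rightward

datatype site = Vacant | Particle

abbreviation config_space :: "('i \<Rightarrow> 's) measure" where
  "config_space \<equiv> PiM UNIV (\<lambda>_. count_space UNIV)"

text \<open>Independence of two random variables. The library's \<open>indep_var\<close> forces both variables
  to have the same value type; this is its characterisation \<open>indep_var_eq\<close> with the two
  value types allowed to differ.\<close>

definition indep_rv ::
  "'w measure \<Rightarrow> 's measure \<Rightarrow> ('w \<Rightarrow> 's) \<Rightarrow> 't measure \<Rightarrow> ('w \<Rightarrow> 't) \<Rightarrow> bool" where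
  "indep_rv M S X T Y \<longleftrightarrow>
     X \<in> measurable M S \<and> Y \<in> measurable M T \<and>
     prob_space.indep_set M
       (sigma_sets (space M) {X -` E \<inter> space M | E. E \<in> sets S})
       (sigma_sets (space M) {Y -` E \<inter> space M | E. E \<in> sets T})"

definition update_process :: "'w measure \<Rightarrow> (int \<times> nat \<Rightarrow> 'w \<Rightarrow> update) \<Rightarrow> bool" where
  "update_process M U \<longleftrightarrow>
     prob_space.indep_vars M (\<lambda>_. count_space UNIV) U UNIV \<and>
     (\<forall>p. \<P>(\<omega> in M. U p \<omega> = Upward) = 1/2 \<and> \<P>(\<omega> in M. U p \<omega> = Rightward) = 1/2)"

definition step_A :: "(int \<Rightarrow> bit) \<Rightarrow> (int \<Rightarrow> update) \<Rightarrow> (int \<Rightarrow> bit)" where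
  "step_A x u = (\<lambda>i.
     if (x (i - 1), x i) = (0, 1) \<or>
        ((x (i - 1), x i), u i) \<in> {((0, 0), Rightward), ((1, 1), Upward)}
     then 0 else 1)"

lemma step_A_eq_1_iff:
  "step_A x u i = 1 \<longleftrightarrow>
     (x (i - 1), x i) = (1, 0) \<or>
     ((x (i - 1), x i), u i) \<in> {((0, 0), Upward), ((1, 1), Rightward)}"
  by (cases "x (i - 1)"; cases "x i"; cases "u i") (auto simp: step_A_def)

definition step_B :: "(int \<Rightarrow> site) \<Rightarrow> (int \<Rightarrow> update) \<Rightarrow> (int \<Rightarrow> site)" where
  "step_B y u = (\<lambda>i.
     if ((y (i - 1), y i) = (Particle, Vacant) \<and> u (i - 1) = Rightward) \<or>
        ((y (i - 1), y i) = (Vacant, Particle) \<and> u i = Upward) \<or>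
        ((y (i - 1), y i) = (Particle, Particle) \<and>
           (u (i - 1), u i) \<in> {(Upward, Upward), (Rightward, Rightward)})
     then Particle else Vacant)"

definition realization ::
  "((int \<Rightarrow> 's) \<Rightarrow> (int \<Rightarrow> update) \<Rightarrow> (int \<Rightarrow> 's)) \<Rightarrow> 'w measure \<Rightarrow> (nat \<Rightarrow> 'w \<Rightarrow> int \<Rightarrow> 's) \<Rightarrow> bool" where
  "realization step M X \<longleftrightarrow>
     prob_space M \<and>
     (\<exists>U. update_process M U \<and>
          indep_rv M config_space (X 0) config_space (\<lambda>\<omega> p. U p \<omega>) \<and>
          (\<forall>n. \<forall>\<omega>\<in>space M. X (Suc n) \<omega> = step (X n \<omega>) (\<lambda>i. U (i, n) \<omega>)))"

definition d :: "nat \<Rightarrow> real" where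
  "d n = real ((2 * n + 1) choose n) / 4 ^ n"

end

theory Submission
  imports Defs
begin

text \<open>Modulo 2, model \<open>B\<close> is linear: a particle at \<open>i\<close> is passed on to \<open>i\<close> or to \<open>i + 1\<close>,
  according to \<open>u\<^sub>i\<close>. Hence the parity of the number of particles in an interval at time \<open>n + 1\<close>
  equals the parity at time \<open>n\<close> in an interval whose two endpoints have moved independently, each
  by \<open>0\<close> or \<open>-1\<close> with probability 1/2. The probability of odd parity in an interval of length \<open>l\<close>
  thus satisfies the recursion of a lazy random walk absorbed at \<open>l = 0\<close>, which is solved by a
  binomial sum; \<open>l = 1\<close> gives the density. The sites of model \<open>A\<close> that agree with their left
  neighbour evolve as the particles of model \<open>B\<close>.\<close>

section \<open>Interval parities under the linear particle flow\<close>

definition parity :: "(int \<Rightarrow> bit) \<Rightarrow> int \<Rightarrow> nat \<Rightarrow> bit" where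
  "parity e a l = (\<Sum>k<l. e (a + int k))"

text \<open>Addition in \<open>bit\<close> is modulo 2, so two particles arriving at one site
  annihilate without any interaction term.\<close>

definition flow :: "(int \<Rightarrow> bit) \<Rightarrow> (int \<Rightarrow> update) \<Rightarrow> int \<Rightarrow> bit" where
  "flow e u = (\<lambda>i. (if u (i - 1) = Rightward then e (i - 1) else 0) + (if u i = Upward then e i else 0))"

lemma parity_0 [simp]: "parity e a 0 = 0"
  by (simp add: parity_def)

lemma parity_Suc: "parity e a (Suc l) = parity e a l + e (a + int l)"
  by (simp add: parity_def)

lemma parity_Suc_left: "parity e (a - 1) (Suc l) = e (a - 1) + parity e a l"
  unfolding parity_def sum.lessThan_Suc_shift by (simp add: algebra_simps)

lemma parity_1 [simp]: "parity e a (Suc 0) = e a"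
  by (simp add: parity_Suc)

text \<open>Particles at \<open>a\<close>, ..., \<open>a + int l - 1\<close> stay inside the
  interval of length \<open>Suc l\<close> whichever way they go; only the inflow from
  \<open>a - 1\<close> and the outflow from \<open>a + int l\<close> depend on the updates.\<close>

lemma parity_flow_Suc:
  "parity (flow e u) a (Suc l) = parity e a l
     + (if u (a - 1) = Rightward then e (a - 1) else 0)
     + (if u (a + int l) = Upward then e (a + int l) else 0)"
proof (induction l)
  case 0
  then show ?case by (simp add: flow_def)
next
  case (Suc l)
  have [simp]: "a + (1 + int l) - 1 = a + int l" by simp
  show ?case
    unfolding parity_Suc[of "flow e u" a "Suc l"] Suc
    by (cases "u (a + int l)"; cases "parity e a l"; cases "e (a + int l)"; cases "e (a - 1)")
      (simp_all add: flow_def parity_Suc algebra_simps)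
qed

text \<open>With length \<open>Suc l\<close> the controlling sites \<open>a - 1\<close> and
  \<open>a + int l\<close> are distinct, so for a random \<open>u\<close> from an update process
  their updates are independent.\<close>

lemma parity_flow:
  "parity (flow e u) a (Suc l) =
     (case (u (a - 1), u (a + int l)) of
        (Upward, Upward) \<Rightarrow> parity e a (Suc l)
      | (Upward, Rightward) \<Rightarrow> parity e a l
      | (Rightward, Upward) \<Rightarrow> parity e (a - 1) (Suc (Suc l))
      | (Rightward, Rightward) \<Rightarrow> parity e (a - 1) (Suc l))"
  unfolding parity_flow_Suc parity_Suc_left
  by (auto simp: parity_Suc algebra_simps split: update.split)

section \<open>The absorbed lazy walk and its binomial solution\<close>

text \<open>\<open>q l\<close> stands for the initial probability of odd parity on an interval of
  length \<open>l\<close>; the length changes by -1, 0, 1 with weights 1/4, 1/2, 1/4.\<close>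

fun odd_prob :: "(nat \<Rightarrow> real) \<Rightarrow> nat \<Rightarrow> nat \<Rightarrow> real" where
  "odd_prob q 0 l = q l"
| "odd_prob q (Suc n) 0 = 0"
| "odd_prob q (Suc n) (Suc l) =
     (odd_prob q n l + 2 * odd_prob q n (Suc l) + odd_prob q n (Suc (Suc l))) / 4"

text \<open>Homogeneity in time: the first step can be moved into the initial function, which later
  reduces the fully occupied start to the fair one.\<close>

lemma odd_prob_Suc:
  assumes "\<And>l. odd_prob q 1 l = q' l"
  shows "odd_prob q (Suc n) l = odd_prob q' n l"
proof (induction n arbitrary: l)
  case 0
  then show ?case using assms by simp
next
  case (Suc n)
  show ?case
    by (cases l) (simp_all only: odd_prob.simps(2,3)[of q "Suc n"] odd_prob.simps(2,3)[of q' n] Suc.IH)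
qed

text \<open>Pascal's rule applied twice; 1, 2, 1 are the walk's weights up to the factor
  1/4.\<close>

lemma choose_Suc_Suc_twice:
  "Suc (Suc m) choose Suc (Suc k) = (m choose k) + 2 * (m choose Suc k) + (m choose Suc (Suc k))"
  by simp

text \<open>The binomial sum below is \<open>\<Sum>\<close> over \<open>-l < j \<le> l\<close> of \<open>(2 * n) choose (n + j)\<close> (reflection
  principle), with the terms \<open>j = -k\<close> and \<open>j = k + 1\<close> merged so that no index is truncated.\<close>

lemma binomial_sum_rec:
  fixes F :: "nat \<Rightarrow> nat \<Rightarrow> nat"
  defines "F \<equiv> \<lambda>n l. \<Sum>k<l. (2 * n + 1) choose (n + 1 + k)"
  shows "F (Suc n) (Suc l) = F n l + 2 * F n (Suc l) + F n (Suc (Suc l))"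
proof (induction l)
  case 0
  \<comment> \<open>\<open>F n 0\<close> is empty, so the lowest term of the double Pascal rule must
    supply the first term of \<open>F n 2\<close>; symmetry identifies the two.\<close>
  have "(2 * n + 1) choose n = (2 * n + 1) choose (n + 1)"
    by (subst binomial_symmetric) auto
  then show ?case
    using choose_Suc_Suc_twice[of "2 * n + 1" n] by (simp add: F_def del: binomial_Suc_Suc)
next
  case (Suc l)
  then show ?case
    using choose_Suc_Suc_twice[of "2 * n + 1" "n + 1 + l"]
    by (simp add: F_def del: binomial_Suc_Suc)
qed

text \<open>The binomial sum obeys the walk's recursion; each step contributes a factor 1/4 and the
  initial value the factor 1/2. At \<open>n = 0\<close> only the term \<open>k = 0\<close>
  survives.\<close>

lemma odd_prob_half:
  "odd_prob (\<lambda>l. if l = 0 then 0 else 1/2) n l =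
     real (\<Sum>k<l. (2 * n + 1) choose (n + 1 + k)) / (2 * 4 ^ n)"
proof (induction n arbitrary: l)
  case 0
  have "(\<Sum>k<l. 1 choose (1 + k)) = (if l = 0 then 0 else 1 :: nat)"
  proof (induction l)
    case (Suc l)
    then show ?case by (cases l) auto
  qed simp
  then show ?case by (simp del: binomial_Suc_Suc)
next
  case (Suc n)
  show ?case
  proof (cases l)
    case 0
    then show ?thesis by simp
  next
    case (Suc m)
    show ?thesis
      unfolding Suc odd_prob.simps Suc.IH binomial_sum_rec by (simp add: field_simps)
  qed
qed

lemma odd_prob_half_1: "odd_prob (\<lambda>l. if l = 0 then 0 else 1/2) n 1 = d n / 2"
proof -
  have "(2 * n + 1) choose (n + 1) = (2 * n + 1) choose n"
    by (subst binomial_symmetric) auto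
  then show ?thesis by (simp add: odd_prob_half d_def)
qed

text \<open>One step mixes even and odd lengths with total weight 1/2 each, so every nonempty
  interval becomes fair. The fair case then runs for the remaining \<open>n - 1\<close>
  steps.\<close>

lemma odd_prob_full_1:
  assumes "n \<ge> 1"
  shows "odd_prob (\<lambda>l. of_bool (odd l)) n 1 = d (n - 1) / 2"
proof -
  obtain m where m: "n = Suc m" using assms by (cases n) auto
  have "odd_prob (\<lambda>l. of_bool (odd l)) 1 l = (if l = 0 then 0 else 1/2)" for l
    unfolding One_nat_def by (cases l) auto
  from odd_prob_Suc[OF this] show ?thesis
    unfolding m by (simp only: odd_prob_half_1) (simp add: odd_prob_half_1[symmetric])
qed

section \<open>Parity probabilities along the random flow\<close>

text \<open>Common abstraction of both models. \<open>initial_indep\<close> combines independence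
  from the start with the fairness of the updates, in the finite form that the induction
  consumes.\<close>

locale annihilating_system = prob_space M for M :: "'w measure" +
  fixes U :: "int \<times> nat \<Rightarrow> 'w \<Rightarrow> update" and E :: "nat \<Rightarrow> 'w \<Rightarrow> int \<Rightarrow> bit"
  assumes U_measurable [measurable]: "U p \<in> measurable M (count_space UNIV)"
    and E_0_measurable: "Measurable.pred M (\<lambda>\<omega>. E 0 \<omega> i = 1)"
    and E_Suc: "\<omega> \<in> space M \<Longrightarrow> E (Suc n) \<omega> = flow (E n \<omega>) (\<lambda>i. U (i, n) \<omega>)"
    and initial_indep: "finite J \<Longrightarrow>
      \<P>(\<omega> in M. parity (E 0 \<omega>) a l = 1 \<and> (\<forall>j\<in>J. U j \<omega> = v j)) =
      \<P>(\<omega> in M. parity (E 0 \<omega>) a l = 1) * (1/2) ^ card J"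

lemma pred_bit_add:
  fixes f g :: "'w \<Rightarrow> bit"
  assumes [measurable]: "Measurable.pred M (\<lambda>\<omega>. f \<omega> = 1)" "Measurable.pred M (\<lambda>\<omega>. g \<omega> = 1)"
  shows "Measurable.pred M (\<lambda>\<omega>. f \<omega> + g \<omega> = 1)"
proof -
  have "f \<omega> + g \<omega> = 1 \<longleftrightarrow> \<not> (f \<omega> = 1 \<longleftrightarrow> g \<omega> = 1)" for \<omega>
    by (cases "f \<omega>"; cases "g \<omega>") auto
  then show ?thesis by (simp only:) measurable
qed

lemma pred_parity:
  assumes "\<And>i. Measurable.pred M (\<lambda>\<omega>. f \<omega> i = 1)"
  shows "Measurable.pred M (\<lambda>\<omega>. parity (f \<omega>) a l = 1)"
proof (induction l)
  case (Suc l)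
  show ?case unfolding parity_Suc by (intro pred_bit_add Suc assms)
qed simp

context annihilating_system
begin

lemma E_measurable: "Measurable.pred M (\<lambda>\<omega>. E n \<omega> i = 1)"
proof (induction n arbitrary: i)
  case 0
  then show ?case by (rule E_0_measurable)
next
  case (Suc n)
  note [measurable] = Suc
  have "Measurable.pred M (\<lambda>\<omega>. (if U (j, n) \<omega> = b then E n \<omega> j else 0) = 1)" for j b
  proof -
    have "((if U (j, n) \<omega> = b then E n \<omega> j else 0) = 1) \<longleftrightarrow> U (j, n) \<omega> = b \<and> E n \<omega> j = 1" for \<omega>
      by simp
    then show ?thesis by simp
  qed
  from pred_bit_add[OF this[of "i - 1" Rightward] this[of i Upward]]
  show ?case
    by (subst measurable_cong[OF arg_cong[OF E_Suc[THEN fun_cong]]]) (simp_all add: flow_def)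
qed

lemmas parity_measurable [measurable] = pred_parity[OF E_measurable]

lemma prob_split_update:
  assumes [measurable]: "Measurable.pred M P"
  shows "\<P>(\<omega> in M. P \<omega>) =
    \<P>(\<omega> in M. P \<omega> \<and> U p \<omega> = Upward) + \<P>(\<omega> in M. P \<omega> \<and> U p \<omega> = Rightward)"
proof -
  have "{\<omega> \<in> space M. P \<omega>} =
      {\<omega> \<in> space M. P \<omega> \<and> U p \<omega> = Upward} \<union> {\<omega> \<in> space M. P \<omega> \<and> U p \<omega> = Rightward}"
    using update.exhaust by blast
  then show ?thesis by (simp, intro finite_measure_Union) auto
qed

text \<open>The times in \<open>J\<close> lie in the future of \<open>E n\<close>; carrying these update variables along replaces
  an independence argument for the \<open>\<sigma>\<close>-algebra generated by the past.\<close>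

lemma prob_parity_updates:
  assumes initial: "\<And>a l. \<P>(\<omega> in M. parity (E 0 \<omega>) a l = 1) = q l"
    and "finite J" "\<And>i k. (i, k) \<in> J \<Longrightarrow> n \<le> k"
  shows "\<P>(\<omega> in M. parity (E n \<omega>) a l = 1 \<and> (\<forall>j\<in>J. U j \<omega> = v j)) =
    odd_prob q n l * (1/2) ^ card J"
  using assms(2,3)
proof (induction n arbitrary: a l J v)
  case 0
  then show ?case by (simp add: initial_indep initial)
next
  case (Suc n)
  note [measurable] = \<open>finite J\<close>
  show ?case
  proof (cases l)
    case 0
    then show ?thesis by simp
  next
    case (Suc m)
    let ?l = "(a - 1, n)" and ?r = "(a + int m, n)"
    let ?P = "\<lambda>\<omega>. parity (E (Suc n) \<omega>) a (Suc m) = 1 \<and> (\<forall>j\<in>J. U j \<omega> = v j)"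
    define J' where "J' = insert ?l (insert ?r J)"
    have new: "?l \<notin> J" "?r \<notin> J"
      using Suc.prems(2) by fastforce+
    \<comment> \<open>The sites \<open>a - 1\<close> and \<open>a + int m\<close> differ and
      \<open>J\<close> contains only later times, so two new conditions are added.\<close>
    then have card: "card J' = card J + 2"
      using \<open>finite J\<close> by (simp add: J'_def)
    have fin: "finite J'" and times: "\<And>i k. (i, k) \<in> J' \<Longrightarrow> n \<le> k"
      using Suc.prems by (auto simp: J'_def dest: Suc_leD)
    \<comment> \<open>Fixing both boundary updates determines the earlier interval; the two fixed
      values join \<open>J\<close> and cost the factor 1/4.\<close>
    have part: "\<P>(\<omega> in M. (?P \<omega> \<and> U ?l \<omega> = b) \<and> U ?r \<omega> = c) = odd_prob q n l' * (1/2) ^ card J / 4"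
      if "\<And>e u. u (a - 1) = b \<Longrightarrow> u (a + int m) = c \<Longrightarrow> parity (flow e u) a (Suc m) = parity e a' l'"
      for b c a' l'
    proof -
      have "{\<omega> \<in> space M. (?P \<omega> \<and> U ?l \<omega> = b) \<and> U ?r \<omega> = c} =
        {\<omega> \<in> space M. parity (E n \<omega>) a' l' = 1 \<and> (\<forall>j\<in>J'. U j \<omega> = (v(?l := b, ?r := c)) j)}"
        using new by (auto simp: J'_def E_Suc that)
      then show ?thesis
        by (simp only: Suc.IH[OF fin times]) (simp add: card)
    qed
    \<comment> \<open>The summands belong to the update pairs at \<open>?l\<close> and
      \<open>?r\<close> in the order up-up, up-right, right-up, right-right.\<close>
    have "\<P>(\<omega> in M. ?P \<omega>) =
      (odd_prob q n (Suc m) * (1/2) ^ card J / 4 + odd_prob q n m * (1/2) ^ card J / 4) +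
      (odd_prob q n (Suc (Suc m)) * (1/2) ^ card J / 4 + odd_prob q n (Suc m) * (1/2) ^ card J / 4)"
      by (subst prob_split_update[of _ ?l], measurable,
          subst (1 2) prob_split_update[of _ ?r], measurable)
        (intro arg_cong2[where f = "(+)"] part; simp add: parity_flow)
    then show ?thesis
      unfolding Suc by (simp add: algebra_simps add_divide_distrib)
  qed
qed

lemma prob_occupied:
  assumes "\<And>a l. \<P>(\<omega> in M. parity (E 0 \<omega>) a l = 1) = q l"
  shows "\<P>(\<omega> in M. E n \<omega> i = 1) = odd_prob q n 1"
  using prob_parity_updates[OF assms, of "{}" n i 1] by simp

end

section \<open>From realizations to annihilating systems\<close>

lemma (in prob_space) prob_fair_cylinder:
  fixes W :: "'i \<Rightarrow> 'a \<Rightarrow> 's"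
  assumes indep: "indep_vars (\<lambda>_. count_space UNIV) W UNIV"
    and fair: "\<And>p s. \<P>(\<omega> in M. W p \<omega> = s) = 1/2"
    and "finite J"
  shows "\<P>(\<omega> in M. \<forall>j\<in>J. W j \<omega> = v j) = (1/2) ^ card J"
proof (cases "J = {}")
  case True
  then show ?thesis by (simp add: prob_space)
next
  case False
  have "{\<omega> \<in> space M. \<forall>j\<in>J. W j \<omega> = v j} = (\<Inter>j\<in>J. W j -` {v j} \<inter> space M)"
    using False by auto
  then have "\<P>(\<omega> in M. \<forall>j\<in>J. W j \<omega> = v j) = (\<Prod>j\<in>J. prob (W j -` {v j} \<inter> space M))"
    using indep_varsD[OF indep False \<open>finite J\<close>, of "\<lambda>j. {v j}"] by simp
  also have "\<dots> = (\<Prod>j\<in>J. 1/2)"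
  proof (rule prod.cong)
    fix j
    have "W j -` {v j} \<inter> space M = {\<omega> \<in> space M. W j \<omega> = v j}" by auto
    then show "prob (W j -` {v j} \<inter> space M) = 1/2" by (simp add: fair)
  qed simp
  finally show ?thesis by simp
qed

lemma space_config_space [simp]: "space config_space = UNIV"
  by (simp add: space_PiM)

lemma coordinate_measurable: "(\<lambda>x. x i) \<in> measurable config_space (count_space UNIV)"
  by (rule measurable_component_singleton) simp

text \<open>\<open>e\<close> is a factor map onto the linear flow. Independence of
  \<open>X 0\<close> and the updates is tested on a parity event and a finite cylinder, whose
  probability is known from fairness.\<close>

lemma realization_annihilating_system:
  fixes e :: "(int \<Rightarrow> 's) \<Rightarrow> int \<Rightarrow> bit"
  assumes real: "realization step M X"
    and step: "\<And>x u. e (step x u) = flow (e x) u"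
    and e: "\<And>i. Measurable.pred config_space (\<lambda>x. e x i = 1)"
  shows "\<exists>U. annihilating_system M U (\<lambda>n \<omega>. e (X n \<omega>))"
proof -
  from real interpret prob_space M by (simp add: realization_def)
  obtain U where U: "update_process M U"
    and indep: "indep_rv M config_space (X 0) config_space (\<lambda>\<omega> p. U p \<omega>)"
    and X: "\<And>n \<omega>. \<omega> \<in> space M \<Longrightarrow> X (Suc n) \<omega> = step (X n \<omega>) (\<lambda>i. U (i, n) \<omega>)"
    using real unfolding realization_def by blast
  have U_indep: "indep_vars (\<lambda>_. count_space UNIV) U UNIV"
    using U by (simp add: update_process_def)
  have U_fair: "\<P>(\<omega> in M. U p \<omega> = s) = 1/2" for p s
    using U unfolding update_process_def by (metis update.exhaust)
  have X_0: "X 0 \<in> measurable M config_space"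
    using indep by (simp add: indep_rv_def)
  have "annihilating_system M U (\<lambda>n \<omega>. e (X n \<omega>))"
  proof (intro annihilating_system.intro annihilating_system_axioms.intro)
    show "U p \<in> measurable M (count_space UNIV)" for p
      using U_indep unfolding indep_vars_def2 by blast
    show "Measurable.pred M (\<lambda>\<omega>. e (X 0 \<omega>) i = 1)" for i
      using measurable_compose[OF X_0 e] .
    show "e (X (Suc n) \<omega>) = flow (e (X n \<omega>)) (\<lambda>i. U (i, n) \<omega>)" if "\<omega> \<in> space M" for n \<omega>
      by (simp add: X[OF that] step)
    fix J :: "(int \<times> nat) set" and a l and v :: "int \<times> nat \<Rightarrow> update"
    assume J: "finite J"
    let ?E = "{x. parity (e x) a l = 1}" and ?V = "{u. \<forall>j\<in>J. u j = v j}"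
    have E: "?E \<in> sets config_space"
      using pred_parity[OF e] by (simp add: pred_def)
    have "Measurable.pred config_space (\<lambda>u. \<forall>j\<in>J. u j = v j)"
    proof (intro pred_intros_finite J)
      show "Measurable.pred config_space (\<lambda>u. u j = v j)" for j
        by (rule measurable_compose[OF coordinate_measurable]) simp
    qed
    then have V: "?V \<in> sets config_space" by (simp add: pred_def)
    have "prob ((X 0 -` ?E \<inter> space M) \<inter> ((\<lambda>\<omega> p. U p \<omega>) -` ?V \<inter> space M)) =
        prob (X 0 -` ?E \<inter> space M) * prob ((\<lambda>\<omega> p. U p \<omega>) -` ?V \<inter> space M)"
      using indep E V unfolding indep_rv_def by (blast intro: indep_setD sigma_sets.Basic)
    moreover have "(X 0 -` ?E \<inter> space M) \<inter> ((\<lambda>\<omega> p. U p \<omega>) -` ?V \<inter> space M) =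
        {\<omega> \<in> space M. parity (e (X 0 \<omega>)) a l = 1 \<and> (\<forall>j\<in>J. U j \<omega> = v j)}"
      and "X 0 -` ?E \<inter> space M = {\<omega> \<in> space M. parity (e (X 0 \<omega>)) a l = 1}"
      and "(\<lambda>\<omega> p. U p \<omega>) -` ?V \<inter> space M = {\<omega> \<in> space M. \<forall>j\<in>J. U j \<omega> = v j}"
      by auto
    ultimately show "\<P>(\<omega> in M. parity (e (X 0 \<omega>)) a l = 1 \<and> (\<forall>j\<in>J. U j \<omega> = v j)) =
        \<P>(\<omega> in M. parity (e (X 0 \<omega>)) a l = 1) * (1/2) ^ card J"
      using prob_fair_cylinder[OF U_indep U_fair J, of v] by simp
  qed (rule prob_space_axioms)
  then show ?thesis by blast
qed

section \<open>Both models as linear flows\<close>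

definition particles :: "(int \<Rightarrow> site) \<Rightarrow> int \<Rightarrow> bit" where
  "particles y = (\<lambda>i. of_bool (y i = Particle))"

text \<open>Over \<open>bit\<close>, this is 1 exactly when site \<open>i\<close> agrees with its
  left neighbour.\<close>

definition agreements :: "(int \<Rightarrow> bit) \<Rightarrow> int \<Rightarrow> bit" where
  "agreements x = (\<lambda>i. 1 + x (i - 1) + x i)"

text \<open>If both sites are occupied, right-up sends two particles to \<open>i\<close>, which
  cancel, up-right sends none, and equal updates send one.\<close>

lemma particles_step_B: "particles (step_B y u) = flow (particles y) u"
proof
  fix i
  show "particles (step_B y u) i = flow (particles y) u i"
    by (cases "y (i - 1)"; cases "y i"; cases "u (i - 1)"; cases "u i")
      (simp_all add: particles_def flow_def step_B_def)
qed

text \<open>The rule of model \<open>A\<close> copies the left bit and flips it exactly when the two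
  bits agree and the update is \<open>Upward\<close>. Adding the new bits at \<open>i - 1\<close>
  and \<open>i\<close> leaves the agreement at \<open>i - 1\<close> if it moves right, plus that at
  \<open>i\<close> if it stays.\<close>

lemma agreements_step_A: "agreements (step_A x u) = flow (agreements x) u"
proof
  fix i :: int
  have [simp]: "i - 1 - 1 = i - 2" by simp
  show "agreements (step_A x u) i = flow (agreements x) u i"
    by (cases "x (i - 2)"; cases "x (i - 1)"; cases "x i"; cases "u (i - 1)"; cases "u i")
      (simp_all add: agreements_def flow_def step_A_def)
qed

text \<open>The sum telescopes: each inner bit occurs twice and cancels modulo 2.\<close>

lemma parity_agreements:
  "parity (agreements x) a (Suc l) = of_nat (Suc l) + x (a - 1) + x (a + int l)"
proof (induction l)
  case 0
  then show ?case by (simp add: agreements_def)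
next
  case (Suc l)
  have [simp]: "a + (1 + int l) - 1 = a + int l" by simp
  show ?case
    unfolding parity_Suc[of _ a "Suc l"] Suc
    by (cases "x (a - 1)"; cases "x (a + int l)"; cases "x (a + int (Suc l))"; cases "of_nat l :: bit")
      (simp_all add: agreements_def algebra_simps)
qed

lemma parity_all_occupied: "parity (\<lambda>_. 1) a l = of_bool (odd l)"
  by (induction l) (simp_all add: parity_Suc)

lemma particles_measurable: "Measurable.pred config_space (\<lambda>y. particles y i = 1)"
proof -
  have "particles y i = 1 \<longleftrightarrow> y i = Particle" for y
    by (simp add: particles_def)
  then show ?thesis
    using measurable_compose[OF coordinate_measurable, of "\<lambda>s. s = Particle"] by simp
qed

lemma agreements_measurable: "Measurable.pred config_space (\<lambda>x. agreements x i = 1)"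
proof -
  have "Measurable.pred config_space (\<lambda>x. x j = (1 :: bit))" for j :: int
    by (rule measurable_compose[OF coordinate_measurable]) simp
  then show ?thesis
    unfolding agreements_def by (intro pred_bit_add) auto
qed

lemma prob_occupied_realization:
  fixes e :: "(int \<Rightarrow> 's) \<Rightarrow> int \<Rightarrow> bit"
  assumes "realization step M X"
    and "\<And>x u. e (step x u) = flow (e x) u"
    and "\<And>i. Measurable.pred config_space (\<lambda>x. e x i = 1)"
    and initial: "\<And>a l. \<P>(\<omega> in M. parity (e (X 0 \<omega>)) a l = 1) = q l"
  shows "\<P>(\<omega> in M. e (X n \<omega>) i = 1) = odd_prob q n 1"
proof -
  obtain U where "annihilating_system M U (\<lambda>n \<omega>. e (X n \<omega>))"
    using realization_annihilating_system[OF assms(1-3)] by blast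
  then interpret annihilating_system M U "\<lambda>n \<omega>. e (X n \<omega>)" .
  show ?thesis by (rule prob_occupied[OF initial])
qed

section \<open>Parity laws of the random initial configurations\<close>

text \<open>One further independent fair site makes any parity fair. The induction carries
  prescribed values at sites to the right of the interval in place of an independence
  argument.\<close>

lemma (in prob_space) prob_parity_particles_fair:
  assumes indep: "indep_vars (\<lambda>_. count_space UNIV) (\<lambda>i \<omega>. Y \<omega> i) UNIV"
    and fair: "\<And>i s. \<P>(\<omega> in M. Y \<omega> i = s) = 1/2"
  shows "\<P>(\<omega> in M. parity (particles (Y \<omega>)) a l = 1) = (if l = 0 then 0 else 1/2)"
proof -
  have Y [measurable]: "(\<lambda>\<omega>. Y \<omega> i) \<in> measurable M (count_space UNIV)" for i
    using indep by (simp add: indep_vars_def2)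
  have "Measurable.pred M (\<lambda>\<omega>. particles (Y \<omega>) i = 1)" for i
    unfolding particles_def by simp
  note [measurable] = pred_parity[OF this]
  have "\<P>(\<omega> in M. parity (particles (Y \<omega>)) a l = 1 \<and> (\<forall>j\<in>J. Y \<omega> j = v j)) =
      (if l = 0 then 0 else 1/2) * (1/2) ^ card J"
    if "finite J" "\<And>j. j \<in> J \<Longrightarrow> a + int l \<le> j" for J v
    using that
  proof (induction l arbitrary: J v)
    case 0
    then show ?case by simp
  next
    case (Suc l)
    note [measurable] = \<open>finite J\<close>
    let ?p = "a + int l"
    let ?J = "insert ?p J"
    let ?w = "\<lambda>s. v(?p := s)"
    have new: "?p \<notin> J" using Suc.prems(2)[of ?p] by auto
    then have card: "card ?J = Suc (card J)" using Suc.prems by simp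
    have J: "finite ?J" "\<And>j. j \<in> ?J \<Longrightarrow> a + int l \<le> j"
      using Suc.prems(1) Suc.prems(2) by fastforce+
    let ?C = "{\<omega> \<in> space M. \<forall>j\<in>?J. Y \<omega> j = ?w Particle j}"
    let ?O = "\<lambda>s. {\<omega> \<in> space M. parity (particles (Y \<omega>)) a l = 1 \<and> (\<forall>j\<in>?J. Y \<omega> j = ?w s j)}"
    have "{\<omega> \<in> space M. parity (particles (Y \<omega>)) a (Suc l) = 1 \<and> (\<forall>j\<in>J. Y \<omega> j = v j)} =
        ?O Vacant \<union> (?C - ?O Particle)"
    proof -
      have "parity (particles y) a (Suc l) = 1 \<longleftrightarrow>
          (y ?p = Vacant \<and> parity (particles y) a l = 1 \<or>
           y ?p = Particle \<and> parity (particles y) a l \<noteq> 1)" for y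
        by (cases "y ?p") (simp_all add: parity_Suc particles_def)
      then show ?thesis using new by auto
    qed
    moreover have "?O Vacant \<inter> (?C - ?O Particle) = {}" by auto
    ultimately have "\<P>(\<omega> in M. parity (particles (Y \<omega>)) a (Suc l) = 1 \<and> (\<forall>j\<in>J. Y \<omega> j = v j)) =
        prob (?O Vacant) + (prob ?C - prob (?O Particle))"
      by (simp only:, subst finite_measure_Union) (auto intro!: finite_measure_Diff)
    \<comment> \<open>By the induction hypothesis the two \<open>?O\<close> terms have equal
      probability and cancel, leaving that of the cylinder \<open>?C\<close>.\<close>
    also have "\<dots> = (1/2) ^ card ?J"
      by (simp only: Suc.IH[OF J] prob_fair_cylinder[OF indep fair J(1)])
    finally show ?case by (simp add: card)
  qed
  from this[of "{}"] show ?thesis by simp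
qed

lemma UNIV_bit: "(UNIV :: bit set) = {0, 1}"
  using bit.exhaust by blast

lemma uniform_bit_cylinder:
  fixes J :: "'i set" and v :: "'i \<Rightarrow> bit"
  assumes "finite J"
  shows "measure (PiM UNIV (\<lambda>_. uniform_count_measure UNIV)) {x. \<forall>j\<in>J. x j = v j} = (1/2) ^ card J"
proof -
  have card: "finite (UNIV :: bit set)" "card (UNIV :: bit set) = 2"
    by (simp_all add: UNIV_bit)
  interpret product_prob_space "\<lambda>_::'i. uniform_count_measure (UNIV :: bit set)" UNIV
    by (intro product_prob_spaceI prob_space_uniform_count_measure) (auto simp: UNIV_bit)
  have "{x. \<forall>j\<in>J. x j = v j} = prod_emb UNIV (\<lambda>_. uniform_count_measure UNIV) J (Pi\<^sub>E J (\<lambda>j. {v j}))"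
    by (auto simp: prod_emb_def space_uniform_count_measure PiE_iff restrict_def)
  then show ?thesis
    using measure_PiM_emb[of J "\<lambda>j. {v j}"] assms
    by (simp add: sets_uniform_count_measure measure_uniform_count_measure card)
qed

text \<open>By telescoping, odd parity prescribes only the sum of two distinct boundary bits,
  leaving two of their four equally likely values.\<close>

lemma prob_parity_agreements_uniform:
  fixes X :: "'w \<Rightarrow> int \<Rightarrow> bit"
  assumes X: "X \<in> measurable M config_space"
    and distr: "distr M config_space X = PiM UNIV (\<lambda>_. uniform_count_measure UNIV)"
  shows "\<P>(\<omega> in M. parity (agreements (X \<omega>)) a l = 1) = (if l = 0 then 0 else 1/2)"
proof (cases l)
  case 0
  then show ?thesis by simp
next
  case (Suc m)
  let ?mu = "PiM UNIV (\<lambda>_::int. uniform_count_measure (UNIV :: bit set))"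
  let ?J = "{a - 1, a + int m}"
  let ?V = "\<lambda>s t. {x. \<forall>j\<in>?J. x j = ((\<lambda>_. s)(a - 1 := t)) j}"
  have "prob_space ?mu"
    by (intro prob_space_PiM prob_space_uniform_count_measure) (auto simp: UNIV_bit)
  then interpret mu: prob_space ?mu .
  define s :: bit where "s = of_nat (Suc m)"
  have E: "{x. parity (agreements x) a l = 1} \<in> sets config_space"
    using pred_parity[OF agreements_measurable] by (simp add: pred_def)
  have V: "?V s t \<in> sets ?mu" for s t
  proof -
    have "?V s t \<in> sets config_space"
    proof -
      have "Measurable.pred config_space (\<lambda>x. x i = (b :: bit))" for i :: int and b
        by (rule measurable_compose[OF coordinate_measurable]) simp
      then have "Measurable.pred config_space (\<lambda>x. \<forall>j\<in>?J. x j = ((\<lambda>_. s)(a - 1 := t)) j)"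
        by (intro pred_intros_finite) auto
      then show ?thesis by (simp only: pred_def space_config_space) simp
    qed
    then show ?thesis by (simp flip: distr)
  qed
  have "\<P>(\<omega> in M. parity (agreements (X \<omega>)) a l = 1) = measure ?mu {x. parity (agreements x) a l = 1}"
    unfolding distr[symmetric] using X E by (subst measure_distr) (auto intro!: arg_cong[where f = "measure M"])
  \<comment> \<open>\<open>?V\<close> takes the right boundary bit first; the left one is then
    forced by the length parity \<open>s\<close>.\<close>
  also have "{x. parity (agreements x) a l = 1} = ?V 0 (1 + s) \<union> ?V 1 s"
    unfolding Suc parity_agreements s_def[symmetric]
    by (cases s) auto
  also have "measure ?mu \<dots> = measure ?mu (?V 0 (1 + s)) + measure ?mu (?V 1 s)"
    using V by (intro mu.finite_measure_Union) auto
  also have "\<dots> = 1/2"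
    by (simp only: uniform_bit_cylinder finite.intros) (simp add: power2_eq_square)
  finally show ?thesis using Suc by simp
qed

section \<open>Densities from the four initial laws\<close>

theorem mainTheorem4:
  fixes M :: "'v measure" and A :: "nat \<Rightarrow> 'v \<Rightarrow> int \<Rightarrow> bit"
    and N :: "'w measure" and B :: "nat \<Rightarrow> 'w \<Rightarrow> int \<Rightarrow> site"
  shows
    "(realization step_A M A \<longrightarrow>
       (distr M config_space (A 0) = PiM UNIV (\<lambda>_. uniform_count_measure UNIV) \<longrightarrow>
          (\<forall>n. \<P>(\<omega> in M. (A n \<omega> 0, A n \<omega> 1) \<in> {(0, 0), (1, 1)}) = d n / 2)) \<and>
       (distr M config_space (A 0) = return config_space (\<lambda>_. 1) \<longrightarrow>
          (\<forall>n\<ge>1. \<P>(\<omega> in M. (A n \<omega> 0, A n \<omega> 1) \<in> {(0, 0), (1, 1)}) = d (n - 1) / 2)))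
     \<and>
     (realization step_B N B \<longrightarrow>
       (prob_space.indep_vars N (\<lambda>_. count_space UNIV) (\<lambda>i \<omega>. B 0 \<omega> i) UNIV \<and>
        (\<forall>i. \<P>(\<omega> in N. B 0 \<omega> i = Vacant) = 1/2 \<and> \<P>(\<omega> in N. B 0 \<omega> i = Particle) = 1/2) \<longrightarrow>
          (\<forall>n. \<P>(\<omega> in N. B n \<omega> 0 = Particle) = d n / 2)) \<and>
       ((AE \<omega> in N. B 0 \<omega> = (\<lambda>_. Particle)) \<longrightarrow>
          (\<forall>n\<ge>1. \<P>(\<omega> in N. B n \<omega> 0 = Particle) = d (n - 1) / 2)))"
proof (intro conjI impI)
  assume A: "realization step_A M A"
  have A_0: "A 0 \<in> measurable M config_space"
    using A by (auto simp: realization_def indep_rv_def)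
  have prob: "\<P>(\<omega> in M. (A n \<omega> 0, A n \<omega> 1) \<in> {(0, 0), (1, 1)}) = odd_prob q n 1"
    if "\<And>a l. \<P>(\<omega> in M. parity (agreements (A 0 \<omega>)) a l = 1) = q l" for q n
  proof -
    \<comment> \<open>The pair of sites 0 and 1 is recorded at its right end, hence the evaluation
      at site 1.\<close>
    have "agreements x 1 = 1 \<longleftrightarrow> (x 0, x 1) \<in> {(0, 0), (1, 1)}" for x
      by (cases "x 0"; cases "x 1") (simp_all add: agreements_def)
    then show ?thesis
      using prob_occupied_realization[OF A agreements_step_A agreements_measurable that, of n 1] by simp
  qed
  {
    assume unif: "distr M config_space (A 0) = PiM UNIV (\<lambda>_. uniform_count_measure UNIV)"
    show "\<forall>n. \<P>(\<omega> in M. (A n \<omega> 0, A n \<omega> 1) \<in> {(0, 0), (1, 1)}) = d n / 2"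
      using prob[OF prob_parity_agreements_uniform[OF A_0 unif]] odd_prob_half_1 by simp
  next
    assume ones: "distr M config_space (A 0) = return config_space (\<lambda>_. 1)"
    have "\<P>(\<omega> in M. parity (agreements (A 0 \<omega>)) a l = 1) = of_bool (odd l)" for a l
    proof -
      let ?E = "{x. parity (agreements x) a l = 1}"
      have E: "?E \<in> sets config_space"
        using pred_parity[OF agreements_measurable] by (simp add: pred_def)
      have "\<P>(\<omega> in M. parity (agreements (A 0 \<omega>)) a l = 1) = measure (distr M config_space (A 0)) ?E"
        using A_0 E by (subst measure_distr) (auto intro!: arg_cong[where f = "measure M"])
      also have "\<dots> = indicator ?E (\<lambda>_. 1)"
        unfolding ones using E by (simp add: measure_return)
      \<comment> \<open>In the all-ones configuration every site agrees with its left neighbour,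
        since 1 + 1 + 1 = 1 in \<open>bit\<close>.\<close>
      also have "\<dots> = of_bool (odd l)"
        by (simp add: agreements_def parity_all_occupied indicator_def)
      finally show ?thesis .
    qed
    from prob[OF this]
    show "\<forall>n\<ge>1. \<P>(\<omega> in M. (A n \<omega> 0, A n \<omega> 1) \<in> {(0, 0), (1, 1)}) = d (n - 1) / 2"
      using odd_prob_full_1 by simp
  }
next
  assume B: "realization step_B N B"
  then interpret N: prob_space N by (simp add: realization_def)
  have B_0: "B 0 \<in> measurable N config_space"
    using B by (auto simp: realization_def indep_rv_def)
  have prob: "\<P>(\<omega> in N. B n \<omega> 0 = Particle) = odd_prob q n 1"
    if "\<And>a l. \<P>(\<omega> in N. parity (particles (B 0 \<omega>)) a l = 1) = q l" for q n
    using prob_occupied_realization[OF B particles_step_B particles_measurable that, of n 0]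
    by (simp add: particles_def)
  {
    assume iid: "N.indep_vars (\<lambda>_. count_space UNIV) (\<lambda>i \<omega>. B 0 \<omega> i) UNIV \<and>
        (\<forall>i. \<P>(\<omega> in N. B 0 \<omega> i = Vacant) = 1/2 \<and> \<P>(\<omega> in N. B 0 \<omega> i = Particle) = 1/2)"
    then have "\<P>(\<omega> in N. B 0 \<omega> i = s) = 1/2" for i s
      by (metis site.exhaust)
    from prob[OF N.prob_parity_particles_fair[OF conjunct1[OF iid] this]]
    show "\<forall>n. \<P>(\<omega> in N. B n \<omega> 0 = Particle) = d n / 2"
      using odd_prob_half_1 by simp
  next
    assume full: "AE \<omega> in N. B 0 \<omega> = (\<lambda>_. Particle)"
    have "\<P>(\<omega> in N. parity (particles (B 0 \<omega>)) a l = 1) = of_bool (odd l)" for a l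
    proof -
      have [measurable]: "Measurable.pred N (\<lambda>\<omega>. parity (particles (B 0 \<omega>)) a l = 1)"
        by (rule measurable_compose[OF B_0 pred_parity[OF particles_measurable]])
      have "\<P>(\<omega> in N. parity (particles (B 0 \<omega>)) a l = 1) = \<P>(\<omega> in N. odd l)"
      \<comment> \<open>Full occupation holds almost surely, so the two events are compared up to a
        null set.\<close>
      proof (rule N.finite_measure_eq_AE)
        show "AE \<omega> in N. (\<omega> \<in> {\<omega> \<in> space N. parity (particles (B 0 \<omega>)) a l = 1}) =
            (\<omega> \<in> {\<omega> \<in> space N. odd l})"
          using full by eventually_elim (simp add: particles_def parity_all_occupied)
      qed auto
      then show ?thesis by (simp add: N.prob_space)
    qed
    from prob[OF this]
    show "\<forall>n\<ge>1. \<P>(\<omega> in N. B n \<omega> 0 = Particle) = d (n - 1) / 2"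
      using odd_prob_full_1 by simp
  }
qed

end
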